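(* Let $\mathbf{M}=\bigcup_{\mathcal F}M_i$ be a non-Hausdorff manifold built from an adjunction system $\mathcal F$ of countably many Hausdorff manifolds $M_i$ glued along open subsets $A_{ij}\subseteq M_i$. If the gluing regions $A_{ij}$ have homeomorphic boundaries, then for each $i\in I$ $$\mathsf{Y}^{M_i}=\boldsymbol{\partial}M_i=\bigcup_{j\neq i}\boldsymbol{\partial}^jA_{ij}.$$
   Context: An adjunction system $\mathcal F$ indexed by a set $I$ consists of topological spaces $X_i$, subsets $A_{ij}\subseteq X_i$ (with the subspace topology) and continuous maps $f_{ij}:A_{ij}\to X_j$ such that for all $i,j,k\in I$: (A1) $A_{ii}=X_i$ and $f_{ii}=\mathrm{id}_{X_i}$; (A2) $A_{ji}=f_{ij}(A_{ij})$ and $f_{ij}^{-1}=f_{ji}$ (so $f_{ij}$ is a homeomorphism onto $A_{ji}$); (A3) for each $a\in A_{ij}\cap A_{ik}$ one has $f_{ij}(a)\in A_{jk}$ and $f_{ik}(a)=f_{jk}(f_{ij}(a))$. The adjunction space $\bigcup_{\mathcal F}X_i$ is the quotient (with the quotient topology) of the disjoint union $\bigsqcup_i X_i$ by the equivalence relation $(x,i)\cong(y,j)$ iff $x\in A_{ij}$ and $f_{ij}(x)=y$; the class of $(x,i)$ is $[x,i]$, and $\phi_i:X_i\to\bigcup_{\mathcal F}X_i$ is the canonical injective map $x\mapsto[x,i]$. All manifolds (Hausdorff or not) are locally Euclidean, second-countable and connected; a non-Hausdorff manifold is such a space that is not Hausdorff. Here the indexing set $I$ is countable, $X_i=M_i$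 are Hausdorff manifolds and every $A_{ij}$ is open in $M_i$. The gluing regions have homeomorphic boundaries if, for all $i\neq j$, $A_{ij}$ is a proper subset of $M_i$ and $f_{ij}$ extends to a homeomorphism $\tilde f_{ij}:\mathrm{Cl}(A_{ij})\to\mathrm{Cl}(A_{ji})$, with closures taken in $M_i$ and $M_j$ respectively. $M_i$ is identified with the open subspace $\phi_i(M_i)$ of $\mathbf{M}$, and $A_{ij}$ with $\phi_i(A_{ij})=\phi_j(A_{ji})$. $\boldsymbol{\partial}$ denotes boundary in $\mathbf{M}$; $\boldsymbol{\partial}M_i:=\partial^{\mathbf M}(\phi_i(M_i))$ and $\boldsymbol{\partial}^jA_{ij}:=\big(\partial^{\mathbf M}\phi_i(A_{ij})\big)\cap\phi_j(M_j)$. For $x,y\in\mathbf{M}$, $x\mathsf{Y}y$ means every open neighbourhood of $x$ intersects every open neighbourhood of $y$. For $V\subseteq\mathbf{M}$, $\mathsf{Y}^V:=\{x\in\mathbf{M} : \exists y\in V,\ y\neq x,\ x\mathsf{Y}y\}$. *)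

theory Defs
  imports "HOL-Analysis.Analysis"
begin

definition quotient_topology :: "'a topology \<Rightarrow> ('a \<times> 'a) set \<Rightarrow> 'a set topology" where
  "quotient_topology X r =
     topology (\<lambda>U. U \<subseteq> topspace X // r \<and> openin X {x \<in> topspace X. r `` {x} \<in> U})"

lemma istopology_quotient:
  "istopology (\<lambda>U. U \<subseteq> topspace X // r \<and> openin X {x \<in> topspace X. r `` {x} \<in> U})"
proof -
  have 1: "{x \<in> topspace X. r `` {x} \<in> S \<inter> T} =
           {x \<in> topspace X. r `` {x} \<in> S} \<inter> {x \<in> topspace X. r `` {x} \<in> T}" for S T
    by auto
  have 2: "{x \<in> topspace X. r `` {x} \<in> \<Union>\<K>} =
           (\<Union>K\<in>\<K>. {x \<in> topspace X. r `` {x} \<in> K})" for \<K>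
    by auto
  show ?thesis
    unfolding istopology_def 1 2 by blast
qed

lemma openin_quotient_topology:
  "openin (quotient_topology X r) U \<longleftrightarrow>
     U \<subseteq> topspace X // r \<and> openin X {x \<in> topspace X. r `` {x} \<in> U}"
  by (simp add: quotient_topology_def istopology_quotient)

lemma topspace_quotient_topology [simp]:
  "topspace (quotient_topology X r) = topspace X // r"
proof
  show "topspace (quotient_topology X r) \<subseteq> topspace X // r"
    using openin_quotient_topology [of X r] by blast
  have "{x \<in> topspace X. r `` {x} \<in> topspace X // r} = topspace X"
    by (auto intro: quotientI)
  then have "openin (quotient_topology X r) (topspace X // r)"
    by (simp add: openin_quotient_topology)
  then show "topspace X // r \<subseteq> topspace (quotient_topology X r)"
    by (rule openin_subset)
qed

lemma quotient_map_quotient_topology: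
  "quotient_map X (quotient_topology X r) (\<lambda>x. r `` {x})"
  by (auto simp: quotient_map_def openin_quotient_topology quotient_def)

definition locally_euclidean :: "'a topology \<Rightarrow> bool" where
  "locally_euclidean X \<longleftrightarrow>
     (\<exists>n. \<forall>x \<in> topspace X. \<exists>U V. openin X U \<and> x \<in> U \<and> openin (Euclidean_space n) V \<and>
        subtopology X U homeomorphic_space subtopology (Euclidean_space n) V)"

definition manifold :: "'a topology \<Rightarrow> bool" where
  "manifold X \<longleftrightarrow> locally_euclidean X \<and> second_countable X \<and> connected_space X"

definition hausdorff_manifold :: "'a topology \<Rightarrow> bool" where
  "hausdorff_manifold X \<longleftrightarrow> manifold X \<and> Hausdorff_space X"

definition non_hausdorff_manifold :: "'a topology \<Rightarrow> bool" where
  "non_hausdorff_manifold X \<longleftrightarrow> manifold X \<and> \<not> Hausdorff_space X"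

text \<open>The values of \<open>X\<close>, \<open>A\<close> and \<open>f\<close> at indices outside \<open>I\<close>, and of \<open>f i j\<close>
  outside \<open>A i j\<close>, are irrelevant.\<close>

locale adjunction_system =
  fixes I :: "'i set"
    and X :: "'i \<Rightarrow> 'a topology"
    and A :: "'i \<Rightarrow> 'i \<Rightarrow> 'a set"
    and f :: "'i \<Rightarrow> 'i \<Rightarrow> 'a \<Rightarrow> 'a"
  assumes subset: "\<lbrakk>i \<in> I; j \<in> I\<rbrakk> \<Longrightarrow> A i j \<subseteq> topspace (X i)"
    and cont: "\<lbrakk>i \<in> I; j \<in> I\<rbrakk> \<Longrightarrow> continuous_map (subtopology (X i) (A i j)) (X j) (f i j)"
    and A1_domain: "i \<in> I \<Longrightarrow> A i i = topspace (X i)"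
    and A1_id: "\<lbrakk>i \<in> I; a \<in> topspace (X i)\<rbrakk> \<Longrightarrow> f i i a = a"
    and A2_image: "\<lbrakk>i \<in> I; j \<in> I\<rbrakk> \<Longrightarrow> A j i = f i j ` A i j"
    and A2_inverse: "\<lbrakk>i \<in> I; j \<in> I; a \<in> A i j\<rbrakk> \<Longrightarrow> f j i (f i j a) = a"
    and A3_domain: "\<lbrakk>i \<in> I; j \<in> I; k \<in> I; a \<in> A i j \<inter> A i k\<rbrakk> \<Longrightarrow> f i j a \<in> A j k"
    and A3_cocycle: "\<lbrakk>i \<in> I; j \<in> I; k \<in> I; a \<in> A i j \<inter> A i k\<rbrakk> \<Longrightarrow> f i k a = f j k (f i j a)"

text \<open>Following \<^const>\<open>sum_topology\<close>, the point \<open>x\<close> of the \<open>i\<close>-th summand is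
  written \<open>(i, x)\<close>.\<close>

definition adj_rel ::
  "'i set \<Rightarrow> ('i \<Rightarrow> 'i \<Rightarrow> 'a set) \<Rightarrow> ('i \<Rightarrow> 'i \<Rightarrow> 'a \<Rightarrow> 'a) \<Rightarrow> (('i \<times> 'a) \<times> ('i \<times> 'a)) set"
  where
  "adj_rel I A f = {((i, x), (j, y)) | i x j y. i \<in> I \<and> j \<in> I \<and> x \<in> A i j \<and> f i j x = y}"

lemma (in adjunction_system) equiv_adj_rel:
  "equiv (topspace (sum_topology X I)) (adj_rel I A f)"
proof (rule equivI)
  have in_A: "f i j x \<in> A j i" if "i \<in> I" "j \<in> I" "x \<in> A i j" for i j x
    using that A2_image by blast
  show "adj_rel I A f \<subseteq> topspace (sum_topology X I) \<times> topspace (sum_topology X I)"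
    using subset in_A by (fastforce simp: adj_rel_def)
  show "refl_on (topspace (sum_topology X I)) (adj_rel I A f)"
    by (auto simp: adj_rel_def refl_on_def A1_domain A1_id)
  show "sym (adj_rel I A f)"
    using in_A by (auto simp: adj_rel_def sym_def A2_inverse)
  show "trans (adj_rel I A f)"
  proof (rule transI)
    fix p q r
    assume "(p, q) \<in> adj_rel I A f" "(q, r) \<in> adj_rel I A f"
    then obtain i x j k where p: "p = (i, x)" and r: "r = (k, f j k (f i j x))"
      and I: "i \<in> I" "j \<in> I" "k \<in> I" and x: "x \<in> A i j" and y: "f i j x \<in> A j k"
      by (auto simp: adj_rel_def)
    have yj: "f i j x \<in> A j i \<inter> A j k"
      using in_A I x y by blast
    have "f j i (f i j x) \<in> A i k"
      using A3_domain [OF I(2,1,3) yj] .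
    moreover have "f j k (f i j x) = f i k (f j i (f i j x))"
      using A3_cocycle [OF I(2,1,3) yj] .
    ultimately show "(p, r) \<in> adj_rel I A f"
      using I x by (simp add: p r adj_rel_def A2_inverse)
  qed
qed

definition adj_space ::
  "'i set \<Rightarrow> ('i \<Rightarrow> 'a topology) \<Rightarrow> ('i \<Rightarrow> 'i \<Rightarrow> 'a set) \<Rightarrow> ('i \<Rightarrow> 'i \<Rightarrow> 'a \<Rightarrow> 'a) \<Rightarrow>
   ('i \<times> 'a) set topology" where
  "adj_space I X A f = quotient_topology (sum_topology X I) (adj_rel I A f)"

definition adj_inj ::
  "'i set \<Rightarrow> ('i \<Rightarrow> 'i \<Rightarrow> 'a set) \<Rightarrow> ('i \<Rightarrow> 'i \<Rightarrow> 'a \<Rightarrow> 'a) \<Rightarrow> 'i \<Rightarrow> 'a \<Rightarrow> ('i \<times> 'a) set"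
  where
  "adj_inj I A f i x = adj_rel I A f `` {(i, x)}"

definition homeomorphic_boundaries ::
  "'i set \<Rightarrow> ('i \<Rightarrow> 'a topology) \<Rightarrow> ('i \<Rightarrow> 'i \<Rightarrow> 'a set) \<Rightarrow> ('i \<Rightarrow> 'i \<Rightarrow> 'a \<Rightarrow> 'a) \<Rightarrow> bool"
  where
  "homeomorphic_boundaries I X A f \<longleftrightarrow>
     (\<forall>i\<in>I. \<forall>j\<in>I. i \<noteq> j \<longrightarrow>
        A i j \<subset> topspace (X i) \<and>
        (\<exists>g. homeomorphic_map (subtopology (X i) (X i closure_of A i j))
                              (subtopology (X j) (X j closure_of A j i)) g \<and>
             (\<forall>a \<in> A i j. g a = f i j a)))"

definition piece_boundary ::
  "'i set \<Rightarrow> ('i \<Rightarrow> 'a topology) \<Rightarrow> ('i \<Rightarrow> 'i \<Rightarrow> 'a set) \<Rightarrow> ('i \<Rightarrow> 'i \<Rightarrow> 'a \<Rightarrow> 'a) \<Rightarrow>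
   'i \<Rightarrow> ('i \<times> 'a) set set" where
  "piece_boundary I X A f i = adj_space I X A f frontier_of (adj_inj I A f i ` topspace (X i))"

definition region_boundary ::
  "'i set \<Rightarrow> ('i \<Rightarrow> 'a topology) \<Rightarrow> ('i \<Rightarrow> 'i \<Rightarrow> 'a set) \<Rightarrow> ('i \<Rightarrow> 'i \<Rightarrow> 'a \<Rightarrow> 'a) \<Rightarrow>
   'i \<Rightarrow> 'i \<Rightarrow> ('i \<times> 'a) set set" where
  "region_boundary I X A f i j =
     (adj_space I X A f frontier_of (adj_inj I A f i ` A i j)) \<inter> adj_inj I A f j ` topspace (X j)"

definition inseparable :: "'a topology \<Rightarrow> 'a \<Rightarrow> 'a \<Rightarrow> bool" where
  "inseparable X x y \<longleftrightarrow>
     (\<forall>U V. openin X U \<and> x \<in> U \<and> openin X V \<and> y \<in> V \<longrightarrow> U \<inter> V \<noteq> {})"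

definition hausdorff_violating_set :: "'a topology \<Rightarrow> 'a set \<Rightarrow> 'a set" where
  "hausdorff_violating_set X V = {x \<in> topspace X. \<exists>y \<in> V. y \<noteq> x \<and> inseparable X x y}"

end

theory Submission
  imports Defs
begin

text \<open>
  Each chart \<open>\<phi>\<^sub>i\<close> is an open embedding, and two charts overlap exactly in the gluing
  region, so both boundaries consist of the points outside \<open>M\<^sub>i\<close> that are limits of gluing
  regions. A point inseparable from another point of \<open>M\<^sub>i\<close> is such a limit, and it lies outside
  \<open>M\<^sub>i\<close> because \<open>M\<^sub>i\<close> is open and Hausdorff. Conversely, if \<open>b\<close> is a boundary point of \<open>A\<^sub>j\<^sub>i\<close> in
  \<open>M\<^sub>j\<close>, then its preimage \<open>a\<close> under the extended gluing map is inseparable from it: points of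
  \<open>A\<^sub>i\<^sub>j\<close> near \<open>a\<close> are glued to points of \<open>A\<^sub>j\<^sub>i\<close> near \<open>b\<close>.
\<close>

section \<open>Charts of an adjunction space and their overlaps\<close>

context adjunction_system
begin

text \<open>The gluing relation is an equivalence, so two classes coincide exactly when their
  representatives are related.\<close>

lemma adj_inj_eq_iff:
  assumes "i \<in> I" "j \<in> I" "x \<in> topspace (X i)" "y \<in> topspace (X j)"
  shows "adj_inj I A f i x = adj_inj I A f j y \<longleftrightarrow> x \<in> A i j \<and> f i j x = y"
proof -
  have "adj_inj I A f i x = adj_inj I A f j y \<longleftrightarrow> ((i, x), (j, y)) \<in> adj_rel I A f"
    unfolding adj_inj_def using assms by (intro eq_equiv_class_iff [OF equiv_adj_rel]) auto
  also have "\<dots> \<longleftrightarrow> x \<in> A i j \<and> f i j x = y"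
    using assms by (auto simp: adj_rel_def)
  finally show ?thesis .
qed

lemma inj_on_adj_inj: "i \<in> I \<Longrightarrow> inj_on (adj_inj I A f i) (topspace (X i))"
  by (auto simp: inj_on_def adj_inj_eq_iff A1_id)

lemma topspace_adj_space:
  "topspace (adj_space I X A f) = (\<Union>i\<in>I. adj_inj I A f i ` topspace (X i))"
  by (fastforce simp: adj_space_def quotient_def adj_inj_def)

text \<open>Open sets of a disjoint sum are tested on each summand, so the quotient carries the
  final topology for the charts.\<close>

lemma openin_adj_space:
  "openin (adj_space I X A f) U \<longleftrightarrow>
     U \<subseteq> topspace (adj_space I X A f) \<and>
     (\<forall>i\<in>I. openin (X i) {x \<in> topspace (X i). adj_inj I A f i x \<in> U})"
proof -
  have "{x. (i, x) \<in> {p \<in> topspace (sum_topology X I). adj_rel I A f `` {p} \<in> U}}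
      = {x \<in> topspace (X i). adj_inj I A f i x \<in> U}" if "i \<in> I" for i
    using that by (auto simp: adj_inj_def)
  then show ?thesis
    by (auto simp: adj_space_def openin_quotient_topology openin_sum_topology)
qed

lemma continuous_map_adj_inj:
  "i \<in> I \<Longrightarrow> continuous_map (X i) (adj_space I X A f) (adj_inj I A f i)"
  by (auto simp: continuous_map openin_adj_space topspace_adj_space)

text \<open>This turns questions about a gluing region into questions about intersections of
  pieces.\<close>

lemma adj_inj_image_Int:
  assumes "i \<in> I" "j \<in> I"
  shows "adj_inj I A f i ` topspace (X i) \<inter> adj_inj I A f j ` topspace (X j)
       = adj_inj I A f i ` A i j"
proof -
  have "adj_inj I A f i x \<in> adj_inj I A f j ` topspace (X j)" if "x \<in> A i j" for x
  proof -
    have "f i j x \<in> topspace (X j)"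
      using that assms A2_image subset by blast
    moreover have "adj_inj I A f i x = adj_inj I A f j (f i j x)"
      using that assms calculation subset by (subst adj_inj_eq_iff) auto
    ultimately show ?thesis
      by blast
  qed
  moreover have "x \<in> A i j"
    if "x \<in> topspace (X i)" "adj_inj I A f i x \<in> adj_inj I A f j ` topspace (X j)" for x
    using that assms by (auto simp: adj_inj_eq_iff)
  ultimately show ?thesis
    using subset [OF assms] by blast
qed

lemma adj_inj_glued:
  assumes "i \<in> I" "j \<in> I" "x \<in> A i j"
  shows "adj_inj I A f j (f i j x) = adj_inj I A f i x"
proof -
  have "x \<in> topspace (X i)" "f i j x \<in> topspace (X j)"
    using assms A2_image subset by blast+
  then show ?thesis
    using assms adj_inj_eq_iff by metis
qed

end

lemma inseparable_sym: "inseparable X x y \<Longrightarrow> inseparable X y x"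
  unfolding inseparable_def by blast

lemma inseparable_in_closure_of:
  assumes "inseparable X x y" "x \<in> topspace X" "openin X U" "y \<in> U"
  shows "x \<in> X closure_of U"
  using assms by (fastforce simp: inseparable_def in_closure_of)

section \<open>Open gluing regions: open charts, boundaries and inseparable points\<close>

locale open_adjunction_system = adjunction_system +
  assumes open_region: "\<lbrakk>i \<in> I; j \<in> I\<rbrakk> \<Longrightarrow> openin (X i) (A i j)"
begin

text \<open>Pulled back to \<open>X j\<close>, the image of \<open>U\<close> is the preimage of
  \<open>U\<close> under \<open>f j i\<close>. It is open in \<open>A j i\<close> by continuity,
  hence open in \<open>X j\<close> because \<open>A j i\<close> is.\<close>

lemma open_map_adj_inj:
  assumes "i \<in> I"
  shows "open_map (X i) (adj_space I X A f) (adj_inj I A f i)"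
  unfolding open_map_def
proof (intro allI impI)
  fix U assume U: "openin (X i) U"
  then have "U \<subseteq> topspace (X i)"
    by (rule openin_subset)
  have "openin (X j) {x \<in> topspace (X j). adj_inj I A f j x \<in> adj_inj I A f i ` U}"
    if "j \<in> I" for j
  proof -
    have "{x \<in> topspace (X j). adj_inj I A f j x \<in> adj_inj I A f i ` U}
        = {x \<in> topspace (subtopology (X j) (A j i)). f j i x \<in> U}"
    proof -
      have "adj_inj I A f j x \<in> adj_inj I A f i ` U \<longleftrightarrow> x \<in> A j i \<and> f j i x \<in> U"
        if "x \<in> topspace (X j)" for x
        using \<open>i \<in> I\<close> \<open>j \<in> I\<close> \<open>U \<subseteq> topspace (X i)\<close> that
        by (auto simp: image_iff adj_inj_eq_iff subset_iff)
      then show ?thesis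
        by auto
    qed
    moreover have "openin (subtopology (X j) (A j i)) \<dots>"
      using cont [OF \<open>j \<in> I\<close> \<open>i \<in> I\<close>] U by (rule openin_continuous_map_preimage)
    ultimately show ?thesis
      using open_region [OF \<open>j \<in> I\<close> \<open>i \<in> I\<close>] openin_trans_full by metis
  qed
  then show "openin (adj_space I X A f) (adj_inj I A f i ` U)"
    using \<open>i \<in> I\<close> \<open>U \<subseteq> topspace (X i)\<close> by (auto simp: openin_adj_space topspace_adj_space)
qed

lemma openin_adj_inj_image:
  "\<lbrakk>i \<in> I; openin (X i) U\<rbrakk> \<Longrightarrow> openin (adj_space I X A f) (adj_inj I A f i ` U)"
  using open_map_adj_inj by (simp add: open_map_def)

text \<open>Closures are local: inside the open piece \<open>?P j\<close>, the sets
  \<open>?P i\<close> and \<open>?P i \<inter> ?P j\<close> have the same limit points. The pieces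
  cover the space, so the local boundaries assemble to the global one.\<close>

lemma piece_boundary_eq_Union_region_boundary:
  assumes "i \<in> I"
  shows "piece_boundary I X A f i = (\<Union>j \<in> I - {i}. region_boundary I X A f i j)"
proof -
  let ?Y = "adj_space I X A f"
  let ?P = "\<lambda>j. adj_inj I A f j ` topspace (X j)"
  have openP: "openin ?Y (?P j)" if "j \<in> I" for j
    using that by (simp add: openin_adj_inj_image)
  have local: "?Y frontier_of ?P i \<inter> ?P j = region_boundary I X A f i j" if "j \<in> I" for j
  proof -
    have region: "adj_inj I A f i ` A i j = ?P i \<inter> ?P j"
      using adj_inj_image_Int assms that by simp
    have "?P j \<inter> ?Y closure_of ?P i \<subseteq> ?Y closure_of (?P i \<inter> ?P j)"
      using openin_Int_closure_of_subset [OF openP [OF that], of "?P i"] by (simp add: Int_commute)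
    moreover have "?Y closure_of (?P i \<inter> ?P j) \<subseteq> ?Y closure_of ?P i"
      by (simp add: closure_of_mono)
    \<comment> \<open>Both sets are open, so each frontier is closure minus set, and these
      differences agree within \<open>?P j\<close>.\<close>
    ultimately show ?thesis
      unfolding region_boundary_def region frontier_of_openin [OF openP [OF assms]]
        frontier_of_openin [OF openin_Int [OF openP [OF assms] openP [OF that]]]
      by blast
  qed
  have "?Y frontier_of ?P i = (\<Union>j\<in>I. ?Y frontier_of ?P i \<inter> ?P j)"
    using frontier_of_subset_topspace [of ?Y "?P i"] unfolding topspace_adj_space by blast
  \<comment> \<open>The term for \<open>i\<close> itself is empty, since an open set is disjoint
    from its frontier.\<close>
  also have "\<dots> = (\<Union>j\<in>I - {i}. ?Y frontier_of ?P i \<inter> ?P j)"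
    using frontier_of_openin [OF openP [OF assms]] by blast
  finally show ?thesis
    using local by (simp add: piece_boundary_def)
qed

text \<open>The chart is open and injective, so disjoint neighbourhoods in \<open>X i\<close> stay
  open and disjoint in the glued space.\<close>

lemma inseparable_same_piece:
  assumes "i \<in> I" "Hausdorff_space (X i)" "x \<in> topspace (X i)" "y \<in> topspace (X i)"
    and "inseparable (adj_space I X A f) (adj_inj I A f i x) (adj_inj I A f i y)"
  shows "x = y"
proof (rule ccontr)
  assume "x \<noteq> y"
  then obtain U V where UV: "openin (X i) U" "openin (X i) V" "x \<in> U" "y \<in> V" "disjnt U V"
    using assms(2-4) unfolding Hausdorff_space_def by blast
  have "adj_inj I A f i ` U \<inter> adj_inj I A f i ` V \<noteq> {}"
    using assms(5) openin_adj_inj_image [OF assms(1) UV(1)] openin_adj_inj_image [OF assms(1) UV(2)]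
      imageI [OF UV(3)] imageI [OF UV(4)] unfolding inseparable_def by meson
  moreover have "adj_inj I A f i ` U \<inter> adj_inj I A f i ` V = adj_inj I A f i ` (U \<inter> V)"
    using inj_on_image_Int [OF inj_on_adj_inj [OF assms(1)] openin_subset [OF UV(1)]
        openin_subset [OF UV(2)]] by (rule sym)
  ultimately show False
    using UV(5) by (simp add: disjnt_def)
qed

lemma hausdorff_violating_set_subset_piece_boundary:
  assumes "i \<in> I" "Hausdorff_space (X i)"
  shows "hausdorff_violating_set (adj_space I X A f) (adj_inj I A f i ` topspace (X i))
       \<subseteq> piece_boundary I X A f i"
proof
  let ?Y = "adj_space I X A f"
  let ?P = "adj_inj I A f i ` topspace (X i)"
  have openP: "openin ?Y ?P"
    using assms by (simp add: openin_adj_inj_image)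
  fix p assume "p \<in> hausdorff_violating_set ?Y ?P"
  then obtain q where q: "p \<in> topspace ?Y" "q \<in> ?P" "q \<noteq> p" "inseparable ?Y p q"
    unfolding hausdorff_violating_set_def by blast
  have "p \<in> ?Y closure_of ?P"
    using inseparable_in_closure_of [OF q(4,1) openP q(2)] .
  \<comment> \<open>Otherwise \<open>p\<close> and \<open>q\<close> would be distinct inseparable
    points of one Hausdorff piece.\<close>
  moreover have "p \<notin> ?P"
    using q inseparable_same_piece [OF assms] by auto
  ultimately show "p \<in> piece_boundary I X A f i"
    using openP by (simp add: piece_boundary_def frontier_of_openin)
qed

text \<open>Near \<open>a\<close> there is a point \<open>x\<close> of \<open>A i j\<close> whose
  class lies in \<open>U\<close> and for which the class of \<open>g x\<close> lies in
  \<open>V\<close>. On \<open>A i j\<close> the map \<open>g\<close> is the gluing map, so these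
  classes are the same point.\<close>

lemma inseparable_glued_closure:
  assumes "i \<in> I" "j \<in> I" "a \<in> X i closure_of A i j"
    and g: "continuous_map (subtopology (X i) (X i closure_of A i j)) (X j) g"
    and ext: "\<And>x. x \<in> A i j \<Longrightarrow> g x = f i j x"
  shows "inseparable (adj_space I X A f) (adj_inj I A f i a) (adj_inj I A f j (g a))"
  unfolding inseparable_def
proof (intro allI impI, elim conjE)
  let ?Y = "adj_space I X A f"
  let ?C = "X i closure_of A i j"
  fix U V
  assume U: "openin ?Y U" "adj_inj I A f i a \<in> U" and V: "openin ?Y V" "adj_inj I A f j (g a) \<in> V"
  have a: "a \<in> topspace (X i)"
    using assms(3) by (simp add: in_closure_of)
  have "continuous_map (subtopology (X i) ?C) ?Y (adj_inj I A f j \<circ> g)"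
    using g continuous_map_adj_inj [OF \<open>j \<in> I\<close>] by (rule continuous_map_compose)
  then have "openin (subtopology (X i) ?C)
      {x \<in> topspace (subtopology (X i) ?C). (adj_inj I A f j \<circ> g) x \<in> V}"
    using V(1) by (rule openin_continuous_map_preimage)
  \<comment> \<open>The preimage of \<open>V\<close> is open only relative to the closure of
    \<open>A i j\<close>. Extending it to \<open>W\<close>, open in \<open>X i\<close>, gives a
    neighbourhood of \<open>a\<close> that must meet \<open>A i j\<close>.\<close>
  then obtain W where W: "openin (X i) W"
    "{x \<in> topspace (subtopology (X i) ?C). (adj_inj I A f j \<circ> g) x \<in> V} = W \<inter> ?C"
    unfolding openin_subtopology by blast
  define U' where "U' = {x \<in> topspace (X i). adj_inj I A f i x \<in> U}"
  have openU': "openin (X i) U'"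
    unfolding U'_def using continuous_map_adj_inj [OF \<open>i \<in> I\<close>] U(1)
    by (rule openin_continuous_map_preimage)
  have "a \<in> W"
  proof -
    have "a \<in> {x \<in> topspace (subtopology (X i) ?C). (adj_inj I A f j \<circ> g) x \<in> V}"
      using a assms(3) V(2) by simp
    then show ?thesis
      unfolding W(2) by blast
  qed
  moreover have "a \<in> U'"
    using a U(2) by (simp add: U'_def)
  ultimately have "a \<in> U' \<inter> W"
    by blast
  then obtain x where x: "x \<in> A i j" "x \<in> U'" "x \<in> W"
    using assms(3) openin_Int [OF openU' W(1)] unfolding in_closure_of by blast
  have "x \<in> ?C"
    using x(1) closure_of_subset [OF subset [OF assms(1,2)]] by blast
  then have "x \<in> {x \<in> topspace (subtopology (X i) ?C). (adj_inj I A f j \<circ> g) x \<in> V}"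
    unfolding W(2) using x by blast
  then have "adj_inj I A f i x \<in> V"
    using x(1) ext adj_inj_glued assms(1,2) by simp
  moreover have "adj_inj I A f i x \<in> U"
    using x(2) by (simp add: U'_def)
  ultimately show "U \<inter> V \<noteq> {}"
    by blast
qed

text \<open>Both charts give the gluing region the same image, so its boundary points in piece
  \<open>j\<close> can be pulled back to \<open>X j\<close>, where the closures of the extended
  gluing maps are taken.\<close>

lemma region_boundary_subset_image_frontier:
  assumes "i \<in> I" "j \<in> I"
  shows "region_boundary I X A f i j \<subseteq> adj_inj I A f j ` (X j frontier_of A j i)"
proof
  let ?Y = "adj_space I X A f"
  have region: "adj_inj I A f i ` A i j = adj_inj I A f j ` A j i"
    using adj_inj_image_Int assms by (metis Int_commute)
  fix p assume "p \<in> region_boundary I X A f i j"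
  then obtain b where b: "b \<in> topspace (X j)" "p = adj_inj I A f j b"
    "adj_inj I A f j b \<in> ?Y frontier_of (adj_inj I A f j ` A j i)"
    by (auto simp: region_boundary_def region)
  moreover have "openin ?Y (adj_inj I A f j ` A j i)"
    using assms open_region by (simp add: openin_adj_inj_image)
  ultimately have closure: "adj_inj I A f j b \<in> ?Y closure_of (adj_inj I A f j ` A j i)"
    and outside: "b \<notin> A j i"
    by (auto simp: frontier_of_openin)
  have "b \<in> X j closure_of A j i"
    unfolding in_closure_of
  proof (intro conjI allI impI b(1), elim conjE)
    \<comment> \<open>The chart image of \<open>V\<close> is open and therefore meets the image of
      \<open>A j i\<close>; injectivity of the chart yields a common point of \<open>V\<close> and
      \<open>A j i\<close>.\<close>
    fix V assume V: "b \<in> V" "openin (X j) V"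
    then obtain y x where yx: "y \<in> A j i" "x \<in> V" "adj_inj I A f j y = adj_inj I A f j x"
      using closure openin_adj_inj_image [OF \<open>j \<in> I\<close> V(2)] unfolding in_closure_of by blast
    then have "y = x"
      using inj_on_adj_inj [OF \<open>j \<in> I\<close>] subset [OF \<open>j \<in> I\<close> \<open>i \<in> I\<close>] openin_subset [OF V(2)]
      by (auto dest: inj_onD)
    then show "\<exists>y. y \<in> A j i \<and> y \<in> V"
      using yx by blast
  qed
  then have "b \<in> X j frontier_of A j i"
    using outside open_region assms by (simp add: frontier_of_openin)
  then show "p \<in> adj_inj I A f j ` (X j frontier_of A j i)"
    using b(2) by blast
qed

lemma region_boundary_subset_hausdorff_violating_set:
  assumes "homeomorphic_boundaries I X A f" "i \<in> I" "j \<in> I" "i \<noteq> j"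
  shows "region_boundary I X A f i j
       \<subseteq> hausdorff_violating_set (adj_space I X A f) (adj_inj I A f i ` topspace (X i))"
proof
  let ?Y = "adj_space I X A f"
  fix p assume "p \<in> region_boundary I X A f i j"
  then obtain b where p: "p = adj_inj I A f j b" and "b \<in> X j frontier_of A j i"
    using region_boundary_subset_image_frontier [OF assms(2,3)] by blast
  then have b: "b \<in> X j closure_of A j i" "b \<notin> A j i"
    using frontier_of_openin [OF open_region [OF assms(3,2)]] by blast+
  then have b_top: "b \<in> topspace (X j)"
    by (simp add: in_closure_of)
  obtain g where g: "homeomorphic_map (subtopology (X i) (X i closure_of A i j))
                       (subtopology (X j) (X j closure_of A j i)) g"
    and ext: "\<And>x. x \<in> A i j \<Longrightarrow> g x = f i j x"
    using assms unfolding homeomorphic_boundaries_def by metis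
  have "b \<in> g ` topspace (subtopology (X i) (X i closure_of A i j))"
    using homeomorphic_imp_surjective_map [OF g] b(1) b_top by simp
  then obtain a where a: "a \<in> topspace (X i)" "a \<in> X i closure_of A i j" "g a = b"
    by auto
  have "continuous_map (subtopology (X i) (X i closure_of A i j)) (X j) g"
    using homeomorphic_imp_continuous_map [OF g] continuous_map_into_fulltopology by blast
  then have "inseparable ?Y (adj_inj I A f i a) (adj_inj I A f j (g a))"
    using ext by (rule inseparable_glued_closure [OF assms(2,3) a(2)])
  then have "inseparable ?Y p (adj_inj I A f i a)"
    unfolding p a(3) by (rule inseparable_sym)
  \<comment> \<open>As \<open>b\<close> lies outside \<open>A j i\<close>, it is glued to no point
    of piece \<open>i\<close>.\<close>
  moreover have "adj_inj I A f i a \<noteq> p"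
    using adj_inj_eq_iff [OF assms(3,2) b_top a(1)] b(2) p by auto
  moreover have "p \<in> topspace ?Y"
    using p b_top assms by (auto simp: topspace_adj_space)
  ultimately show "p \<in> hausdorff_violating_set ?Y (adj_inj I A f i ` topspace (X i))"
    using a(1) unfolding hausdorff_violating_set_def by blast
qed

end

theorem lemma2p4:
  fixes I :: "'i set"
    and M :: "'i \<Rightarrow> 'a topology"
    and A :: "'i \<Rightarrow> 'i \<Rightarrow> 'a set"
    and f :: "'i \<Rightarrow> 'i \<Rightarrow> 'a \<Rightarrow> 'a"
    and i :: 'i
  assumes "countable I"
    and "adjunction_system I M A f"
    and "\<And>i. i \<in> I \<Longrightarrow> hausdorff_manifold (M i)"
    and "\<And>i j. \<lbrakk>i \<in> I; j \<in> I\<rbrakk> \<Longrightarrow> openin (M i) (A i j)"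
    and "non_hausdorff_manifold (adj_space I M A f)"
    and "homeomorphic_boundaries I M A f"
    and "i \<in> I"
  shows "hausdorff_violating_set (adj_space I M A f) (adj_inj I A f i ` topspace (M i))
           = piece_boundary I M A f i
       \<and> piece_boundary I M A f i = (\<Union>j \<in> I - {i}. region_boundary I M A f i j)"
proof -
  interpret open_adjunction_system I M A f
    using assms(2,4) by (simp add: open_adjunction_system_def open_adjunction_system_axioms_def)
  have "Hausdorff_space (M i)"
    using assms(3,7) by (simp add: hausdorff_manifold_def)
  then have "hausdorff_violating_set (adj_space I M A f) (adj_inj I A f i ` topspace (M i))
      \<subseteq> piece_boundary I M A f i"
    using hausdorff_violating_set_subset_piece_boundary assms(7) by blast
  moreover have "(\<Union>j \<in> I - {i}. region_boundary I M A f i j)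
      \<subseteq> hausdorff_violating_set (adj_space I M A f) (adj_inj I A f i ` topspace (M i))"
    using region_boundary_subset_hausdorff_violating_set [OF assms(6,7)] by blast
  \<comment> \<open>The equality closes the cycle of the two inclusions, so all three sets
    agree.\<close>
  ultimately show ?thesis
    using piece_boundary_eq_Union_region_boundary [OF assms(7)] by simp
qed

end
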